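(* (1) Let $j\in\Omega$ and let $x\in\mathcal{S}(\Omega,\mathbb{R})$ satisfy $x_k=0$ for all $k\ge j$. Then for all $\alpha<2^j$ and all $h\in\Omega$, $$\sum_{k\lhd(2^j\odot h\oplus\alpha)}x_k=\sum_{k\lhd\alpha}x_k+\sum_{k\lhd(2^j\odot h)}x_k=\sum_{k\lhd\alpha}x_k;$$ hence $\varphi_x(2^j\odot h\oplus\alpha)=\varphi_x(2^j\odot h)+\varphi_x(\alpha)=\varphi_x(\alpha)$ for all $\alpha<2^j$, $h\in\Omega$, so $\varphi_x$ is $j$-periodic. (2) Conversely, for every $j\in\Omega$ and every $j$-periodic $\psi\in\mathbb{R}^\Omega$ there exists a unique $x\in\mathcal{S}(\Omega,\mathbb{R})$ such that $\psi(2^\alpha)=\varphi_x(2^\alpha)$ for all $\alpha\in\Omega$.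
   Context: $\Omega$ is the set of all ordinals smaller than the least strongly inaccessible cardinal (assumed to exist). $\oplus,\odot$ denote ordinary ordinal addition and multiplication and $2^\alpha$ ordinal exponentiation. Every $\alpha\in\Omega$ has a unique base-2 normal form $\alpha=2^{j_1}\oplus\cdots\oplus2^{j_n}$ with $j_1>\dots>j_n$; put $L_\alpha=\{j_1,\dots,j_n\}$ ($L_0=\emptyset$), and write $k\lhd\alpha$ iff $k\in L_\alpha$; $\sum_{k\lhd\alpha}x_k$ is the ordinary finite sum over $k\in L_\alpha$. $\mathcal{S}(\Omega,\mathbb{R})$ is the set of eventually zero sequences $x\in\mathbb{R}^\Omega$ (i.e. there is $\beta\in\Omega$ with $x_k=0$ for all $k\ge\beta$). The counting function of $x\in\mathcal{S}(\Omega,\mathbb{R})$ is $\varphi_x:\Omega\to\mathbb{R}$, $\varphi_x(\alpha)=\sum_{k\lhd\alpha}x_k$. For $j\in\Omega$, a function $\psi:\Omega\to\mathbb{R}$ is $j$-periodic if $\psi(0)=0$ and $\psi(2^j\odot h\oplus\alpha)=\psi(\alpha)$ for all $\alpha<2^j$ and all $h\in\Omega$. *)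

theory Defs
  imports Complex_Main
begin

unbundle cardinal_syntax

definition strongly_inaccessible :: "'a rel \<Rightarrow> bool" where
  "strongly_inaccessible r \<longleftrightarrow>
     Card_order r \<and> natLeq <o r \<and> regularCard r \<and>
     (\<forall>s :: 'a rel. Card_order s \<and> s <o r \<longrightarrow> ctwo ^c s <o r)"

text \<open>Every well-order smaller than \<open>r\<close> is isomorphic to one on the carrier type of \<open>r\<close>,
  so comparing with relations on the same type loses no generality.\<close>

definition least_strongly_inaccessible :: "'a rel \<Rightarrow> bool" where
  "least_strongly_inaccessible r \<longleftrightarrow>
     strongly_inaccessible r \<and> (\<forall>s :: 'a rel. strongly_inaccessible s \<longrightarrow> r \<le>o s)"

text \<open>
  The set \<open>\<Omega>\<close> of all ordinals below the least strongly inaccessible cardinal is represented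
  by a well-ordered type \<open>'a\<close> whose order relation is least strongly inaccessible: a
  von Neumann ordinal is the well-ordered set of its predecessors, so such a type is \<open>\<Omega>\<close> up
  to a unique order isomorphism, and its elements are the ordinals in \<open>\<Omega>\<close>. The existence of
  the cardinal is thereby a hypothesis on \<open>'a\<close>.
\<close>

abbreviation le_rel :: "'a::wellorder rel" where
  "le_rel \<equiv> {(a, b). a \<le> b}"

definition ozero :: "'a::wellorder" where
  "ozero = (LEAST a. True)"

definition osuc :: "'a::wellorder \<Rightarrow> 'a" where
  "osuc a = (LEAST b. a < b)"

definition osup :: "'a::wellorder set \<Rightarrow> 'a" where
  "osup A = (LEAST b. \<forall>a\<in>A. a \<le> b)"

definition is_succ :: "'a::wellorder \<Rightarrow> bool" where
  "is_succ b \<longleftrightarrow> (\<exists>a<b. b = osuc a)"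

definition opred :: "'a::wellorder \<Rightarrow> 'a" where
  "opred b = (THE a. a < b \<and> b = osuc a)"

lemma osuc_unique:
  fixes a b c :: "'a::wellorder"
  assumes "a < b" "b = osuc a" "c < b" "b = osuc c"
  shows "c = a"
proof (rule linorder_cases[of a c])
  assume "a < c"
  then have "osuc a \<le> c" unfolding osuc_def by (rule Least_le)
  with assms show ?thesis by simp
next
  assume "c < a"
  then have "osuc c \<le> a" unfolding osuc_def by (rule Least_le)
  with assms show ?thesis by simp
qed simp

lemma opred_props:
  fixes b :: "'a::wellorder"
  assumes "is_succ b"
  shows "opred b < b \<and> b = osuc (opred b)"
proof -
  obtain a where a: "a < b \<and> b = osuc a" using assms unfolding is_succ_def by blast
  show ?thesis unfolding opred_def
    by (rule theI[where P = "\<lambda>a. a < b \<and> b = osuc a", OF a]) (use a osuc_unique in blast)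
qed

lemma wf_less_wellorder: "wf {(a, b :: 'a::wellorder). a < b}"
  unfolding wf_def
proof (intro allI impI)
  fix P :: "'a \<Rightarrow> bool" and a
  assume "\<forall>a. (\<forall>b. (b, a) \<in> {(a, b). a < b} \<longrightarrow> P b) \<longrightarrow> P a"
  then show "P a" by (induction a rule: less_induct) simp
qed

text \<open>Transfinite recursion: value \<open>z\<close> at zero, step \<open>s\<close> at successors, supremum at limits.\<close>

function ord_rec :: "'a::wellorder \<Rightarrow> ('a \<Rightarrow> 'a) \<Rightarrow> 'a \<Rightarrow> 'a" where
  "ord_rec z s b =
     (if b = ozero then z
      else if is_succ b then s (ord_rec z s (opred b))
      else osup ((\<lambda>c. ord_rec z s c) ` {..<b}))"
  by auto
termination
  by (relation "inv_image {(a, b). a < b} (\<lambda>(z, s, b). b)")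
    (auto simp: opred_props wf_less_wellorder intro!: wf_inv_image)

declare ord_rec.simps [simp del]

definition oadd :: "'a::wellorder \<Rightarrow> 'a \<Rightarrow> 'a"  (infixl \<open>\<oplus>\<close> 65) where
  "a \<oplus> b = ord_rec a osuc b"

definition omult :: "'a::wellorder \<Rightarrow> 'a \<Rightarrow> 'a"  (infixl \<open>\<odot>\<close> 70) where
  "a \<odot> b = ord_rec ozero (\<lambda>c. c \<oplus> a) b"

definition opow2 :: "'a::wellorder \<Rightarrow> 'a" where
  "opow2 a = ord_rec (osuc ozero) (\<lambda>c. c \<odot> osuc (osuc ozero)) a"

definition normal_form2 :: "'a::wellorder \<Rightarrow> 'a list \<Rightarrow> bool" where
  "normal_form2 a js \<longleftrightarrow>
     sorted_wrt (>) js \<and> a = foldr (\<lambda>j b. opow2 j \<oplus> b) js ozero"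

definition nf_exps :: "'a::wellorder \<Rightarrow> 'a set" where
  "nf_exps a = set (THE js. normal_form2 a js)"

definition ev_zero :: "('a::wellorder \<Rightarrow> real) set" where
  "ev_zero = {x. \<exists>b. \<forall>k\<ge>b. x k = 0}"

definition counting_fun :: "('a::wellorder \<Rightarrow> real) \<Rightarrow> 'a \<Rightarrow> real" where
  "counting_fun x a = (\<Sum>k\<in>nf_exps a. x k)"

definition periodic :: "'a::wellorder \<Rightarrow> ('a \<Rightarrow> real) \<Rightarrow> bool" where
  "periodic j \<psi> \<longleftrightarrow>
     \<psi> ozero = 0 \<and> (\<forall>a < opow2 j. \<forall>h. \<psi> (opow2 j \<odot> h \<oplus> a) = \<psi> a)"

end

theory Submission
  imports Defs
begin

text \<open>
  In \<open>\<Omega>\<close> every small set has a supremum, so sum, product and power of two are normal functions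
  of the last argument, and two normal functions with the same initial value and the same
  successor step coincide. This yields associativity, distributivity and
  \<open>2\<^sup>j \<odot> 2\<^sup>c = 2\<^sup>j\<^sup>\<oplus>\<^sup>c\<close>. Splitting a normal form at exponent \<open>j\<close> is division by \<open>2\<^sup>j\<close>, so the exponents of
  \<open>2\<^sup>j \<odot> h\<close> are all \<open>\<ge> j\<close> and those of \<open>2\<^sup>j \<odot> h \<oplus> \<alpha>\<close> are obtained by adjoining those of \<open>\<alpha>\<close>.
  Conversely \<open>L\<close> of \<open>2\<^sup>k\<close> is \<open>{k}\<close>, so \<open>x\<^sub>k = \<psi>(2\<^sup>k)\<close> is forced, and it vanishes for \<open>k \<ge> j\<close> because \<open>2\<^sup>j\<close>
  then divides \<open>2\<^sup>k\<close> from the left.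
\<close>

section \<open>Zero, limits and normal functions\<close>

lemma ozero_le: "ozero \<le> (a :: 'a::wellorder)"
  unfolding ozero_def by (rule Least_le) simp

lemma osuc_le: "a < b \<Longrightarrow> osuc a \<le> (b :: 'a::wellorder)"
  unfolding osuc_def by (rule Least_le)

lemma ozero_less_iff: "ozero < (a :: 'a::wellorder) \<longleftrightarrow> a \<noteq> ozero"
  using ozero_le[of a] by auto

definition is_limit :: "'a::wellorder \<Rightarrow> bool" where
  "is_limit b \<longleftrightarrow> b \<noteq> ozero \<and> \<not> is_succ b"

text \<open>Continuity is phrased through upper bounds: with strict monotonicity it says that
  \<open>f b\<close> is the supremum of the earlier values.\<close>

definition normal_fun :: "('a::wellorder \<Rightarrow> 'a) \<Rightarrow> bool" where
  "normal_fun f \<longleftrightarrow> strict_mono f \<and>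
     (\<forall>b d. is_limit b \<longrightarrow> (\<forall>c<b. f c \<le> d) \<longrightarrow> f b \<le> d)"

lemma normal_fun_less_iff: "normal_fun f \<Longrightarrow> f a < f b \<longleftrightarrow> a < b"
  and normal_fun_le_iff: "normal_fun f \<Longrightarrow> f a \<le> f b \<longleftrightarrow> a \<le> b"
  and normal_fun_eq_iff: "normal_fun f \<Longrightarrow> f a = f b \<longleftrightarrow> a = b"
  by (simp_all add: normal_fun_def strict_mono_less strict_mono_less_eq strict_mono_eq)

lemma normal_fun_limit_le:
  "\<lbrakk>normal_fun f; is_limit b; \<And>c. c < b \<Longrightarrow> f c \<le> d\<rbrakk> \<Longrightarrow> f b \<le> d"
  by (auto simp: normal_fun_def)

text \<open>If \<open>f a < a\<close>, then monotonicity gives \<open>f (f a) < f a\<close>, against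
  the induction hypothesis at \<open>f a\<close>.\<close>

lemma normal_fun_ge: "normal_fun f \<Longrightarrow> a \<le> f a"
proof (induction a rule: less_induct)
  case (less a)
  show ?case
  proof (rule ccontr)
    assume "\<not> a \<le> f a"
    then have "f (f a) < f a" and "f a \<le> f (f a)"
      using less by (auto simp: normal_fun_less_iff)
    then show False by simp
  qed
qed

text \<open>These two properties provide the upper bounds that make the least elements in
  \<open>osuc\<close> and, over images of initial segments, \<open>osup\<close> meaningful. The
  \<open>itself\<close> parameter only fixes the type.\<close>

locale regular_wellorder =
  fixes carrier_type :: "'a::wellorder itself"
  assumes no_greatest: "\<exists>b. (a::'a) < b"
    and bounded_image: "\<exists>c. \<forall>a<b. (f :: 'a \<Rightarrow> 'a) a \<le> c"
begin

section \<open>Successors, limits and transfinite recursion\<close>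

lemma less_osuc: "(a::'a) < osuc a"
  unfolding osuc_def using no_greatest[of a] by (auto intro: LeastI_ex)

lemma less_osuc_iff: "(a::'a) < osuc b \<longleftrightarrow> a \<le> b"
  using less_osuc[of b] osuc_le[of b a] by (auto simp: not_le[symmetric])

lemma osuc_le_iff: "osuc (a::'a) \<le> b \<longleftrightarrow> a < b"
  using less_osuc_iff[of b a] by (auto simp: not_le[symmetric])

lemma is_succ_osuc: "is_succ (osuc (a::'a))"
  unfolding is_succ_def using less_osuc by blast

lemma opred_osuc: "opred (osuc (a::'a)) = a"
  using opred_props[OF is_succ_osuc[of a]] osuc_unique[OF less_osuc refl] by blast

lemma osuc_neq_ozero: "osuc (a::'a) \<noteq> ozero"
  using less_osuc[of a] ozero_le[of a] by auto

lemma ordinal_cases: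
  fixes b :: 'a
  obtains (zero) "b = ozero" | (suc) a where "b = osuc a" | (limit) "is_limit b"
  unfolding is_limit_def using opred_props by blast

lemma ordinal_induct [case_names zero suc limit]:
  fixes b :: 'a
  assumes "P ozero" and "\<And>a. P a \<Longrightarrow> P (osuc a)"
    and "\<And>b. \<lbrakk>is_limit b; \<And>c. c < b \<Longrightarrow> P c\<rbrakk> \<Longrightarrow> P b"
  shows "P b"
proof (induction b rule: less_induct)
  case (less b)
  show ?case
    by (cases b rule: ordinal_cases) (use assms less less_osuc in auto)
qed

lemma ord_rec_zero: "ord_rec z s ozero = (z::'a)"
  by (simp add: ord_rec.simps)

lemma ord_rec_osuc: "ord_rec z s (osuc b) = s (ord_rec z s (b::'a))"
  by (subst ord_rec.simps) (simp add: is_succ_osuc opred_osuc osuc_neq_ozero)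

lemma ord_rec_limit:
  assumes "is_limit (b::'a)"
  shows "c < b \<Longrightarrow> ord_rec z s c \<le> ord_rec z s b"
    and "(\<And>c. c < b \<Longrightarrow> ord_rec z s c \<le> d) \<Longrightarrow> ord_rec z s b \<le> d"
proof -
  have eq: "ord_rec z s b = (LEAST d. \<forall>a\<in>ord_rec z s ` {..<b}. a \<le> d)"
    using assms by (subst ord_rec.simps) (auto simp: is_limit_def osup_def)
  obtain e where "\<forall>a<b. ord_rec z s a \<le> e"
    using bounded_image by blast
  then have "\<forall>a\<in>ord_rec z s ` {..<b}. a \<le> e" by auto
  then have "\<forall>a\<in>ord_rec z s ` {..<b}. a \<le> ord_rec z s b"
    unfolding eq by (rule LeastI)
  then show "c < b \<Longrightarrow> ord_rec z s c \<le> ord_rec z s b" by auto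
  show "ord_rec z s b \<le> d" if "\<And>c. c < b \<Longrightarrow> ord_rec z s c \<le> d"
    unfolding eq by (rule Least_le) (use that in auto)
qed

lemma is_limit_osuc_less: "\<lbrakk>is_limit (b::'a); a < b\<rbrakk> \<Longrightarrow> osuc a < b"
  using osuc_le[of a b] is_succ_osuc[of a] by (auto simp: is_limit_def order_less_le)

text \<open>All values lie above \<open>z\<close>, so the step has to increase only there; doubling,
  for instance, fixes zero but increases everything from one on.\<close>

lemma normal_fun_ord_rec:
  assumes step: "\<And>c::'a. z \<le> c \<Longrightarrow> c < s c"
  shows "normal_fun (ord_rec z s)"
proof -
  have ge: "z \<le> ord_rec z s b" for b
  proof (induction b rule: ordinal_induct)
    case zero
    then show ?case by (simp add: ord_rec_zero)
  next
    case (suc a)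
    then show ?case using step[of "ord_rec z s a"] by (simp add: ord_rec_osuc)
  next
    case (limit b)
    then show ?case
      using ord_rec_limit(1)[OF limit(1), of ozero z s]
      by (auto simp: ord_rec_zero ozero_less_iff is_limit_def)
  qed
  have suc_less: "ord_rec z s a < ord_rec z s (osuc a)" for a
    using step[OF ge] by (simp add: ord_rec_osuc)
  have mono: "ord_rec z s a < ord_rec z s b" if "a < b" for a b
    using that
  proof (induction b rule: ordinal_induct)
    case zero
    then show ?case using ozero_le[of a] by simp
  next
    case (suc b)
    then show ?case using suc_less[of b] by (auto simp: less_osuc_iff order_le_less)
  next
    case (limit b)
    \<comment> \<open>Going through \<open>osuc a\<close>, still below the limit, turns the weak
      bound at limits into a strict one.\<close>
    have "ord_rec z s (osuc a) \<le> ord_rec z s b"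
      using limit by (intro ord_rec_limit(1) is_limit_osuc_less)
    then show ?case using suc_less[of a] by simp
  qed
  show ?thesis
    unfolding normal_fun_def by (auto intro!: strict_monoI mono intro: ord_rec_limit(2))
qed

lemma normal_fun_limit:
  assumes f: "normal_fun f" and b: "is_limit (b::'a)"
  shows "is_limit (f b)" and "e < f b \<Longrightarrow> \<exists>c<b. e < f c"
proof -
  show *: "\<exists>c<b. e < f c" if "e < f b" for e
    using normal_fun_limit_le[OF f b, of e] that by (auto simp: not_le[symmetric])
  have "f b \<noteq> ozero"
  proof -
    have "f ozero < f b" using f b by (simp add: normal_fun_less_iff ozero_less_iff is_limit_def)
    then show ?thesis using ozero_le[of "f ozero"] by auto
  qed
  moreover have "f b \<noteq> osuc e" for e
  proof
    assume e: "f b = osuc e"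
    then obtain c where "c < b" "e < f c" using * less_osuc by metis
    then have "f b \<le> f c" using e by (simp add: osuc_le_iff)
    then show False using f \<open>c < b\<close> by (simp add: normal_fun_le_iff)
  qed
  ultimately show "is_limit (f b)" by (auto simp: is_limit_def is_succ_def)
qed

text \<open>The inner function sends limits to limits, and its values below \<open>b\<close> are
  cofinal in \<open>g b\<close>.\<close>

lemma normal_fun_comp:
  fixes f g :: "'a \<Rightarrow> 'a"
  assumes f: "normal_fun f" and g: "normal_fun g"
  shows "normal_fun (\<lambda>a. f (g a))"
  unfolding normal_fun_def
proof (intro conjI allI impI)
  show "strict_mono (\<lambda>a. f (g a))"
    using f g by (auto intro!: strict_monoI simp: normal_fun_less_iff)
next
  fix b d
  assume b: "is_limit b" and le: "\<forall>c<b. f (g c) \<le> d"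
  show "f (g b) \<le> d"
  proof (rule normal_fun_limit_le[OF f normal_fun_limit(1)[OF g b]])
    fix e assume "e < g b"
    then obtain c where "c < b" "e < g c" using normal_fun_limit(2)[OF g b] by blast
    then show "f e \<le> d"
      using le f by (meson normal_fun_le_iff order_less_imp_le order_trans)
  qed
qed

text \<open>At a limit both functions are the supremum of the same values. The algebraic laws below
  are instances, read as identities in the last argument.\<close>

lemma normal_fun_ext:
  fixes f g :: "'a \<Rightarrow> 'a"
  assumes f: "normal_fun f" and g: "normal_fun g" and "f ozero = g ozero"
    and "\<And>a. f (osuc a) = s (f a)" and "\<And>a. g (osuc a) = s (g a)"
  shows "f b = g b"
proof (induction b rule: ordinal_induct)
  case (limit b)
  show ?case
  proof (rule antisym)
    show "f b \<le> g b"
      by (rule normal_fun_limit_le[OF f limit(1)])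
        (use limit g in \<open>simp add: normal_fun_le_iff\<close>)
    show "g b \<le> f b"
      by (rule normal_fun_limit_le[OF g limit(1)])
        (use limit f in \<open>simp add: normal_fun_le_iff flip: limit(2)\<close>)
  qed
qed (use assms in simp_all)

text \<open>The least \<open>e\<close> with \<open>d < f e\<close> is not zero by hypothesis and not
  a limit by continuity, so it is a successor. This yields left subtraction and leading
  exponents.\<close>

lemma normal_fun_bracket:
  fixes f :: "'a \<Rightarrow> 'a"
  assumes f: "normal_fun f" and d: "f ozero \<le> d"
  obtains b where "f b \<le> d" and "d < f (osuc b)"
proof -
  define e where "e = (LEAST e. d < f e)"
  have "d < f (osuc d)"
    using normal_fun_ge[OF f, of "osuc d"] less_osuc[of d] by simp
  then have e: "d < f e" unfolding e_def by (rule LeastI)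
  have below: "f c \<le> d" if "c < e" for c
    using not_less_Least[of c "\<lambda>e. d < f e"] that unfolding e_def by simp
  show thesis
  proof (cases e rule: ordinal_cases)
    case zero
    then show ?thesis using e d by simp
  next
    case (suc a)
    then show ?thesis using that e below less_osuc by blast
  next
    case limit
    then show ?thesis using normal_fun_limit_le[OF f limit below] e by simp
  qed
qed

section \<open>Ordinal addition\<close>

lemma oadd_zero [simp]: "a \<oplus> ozero = (a::'a)"
  by (simp add: oadd_def ord_rec_zero)

lemma oadd_osuc: "a \<oplus> osuc b = osuc (a \<oplus> (b::'a))"
  by (simp add: oadd_def ord_rec_osuc)

lemma normal_fun_oadd: "normal_fun (\<lambda>b. a \<oplus> (b::'a))"
  unfolding oadd_def by (rule normal_fun_ord_rec) (rule less_osuc)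

lemmas oadd_less_iff [simp] = normal_fun_less_iff[OF normal_fun_oadd]
lemmas oadd_le_iff [simp] = normal_fun_le_iff[OF normal_fun_oadd]
lemmas oadd_eq_iff [simp] = normal_fun_eq_iff[OF normal_fun_oadd]

lemma le_oadd: "a \<le> a \<oplus> (b::'a)"
  using oadd_le_iff[of a ozero b] ozero_le[of b] by simp

lemma le_oadd_right: "b \<le> a \<oplus> (b::'a)"
  by (rule normal_fun_ge[OF normal_fun_oadd])

lemma less_oadd: "ozero < b \<Longrightarrow> a < a \<oplus> (b::'a)"
  using oadd_less_iff[of a ozero b] by simp

lemma oadd_assoc: "a \<oplus> b \<oplus> c = a \<oplus> (b \<oplus> (c::'a))"
  by (rule normal_fun_ext[where f = "\<lambda>c. a \<oplus> b \<oplus> c" and g = "\<lambda>c. a \<oplus> (b \<oplus> c)" and s = osuc])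
    (simp_all add: normal_fun_oadd normal_fun_comp[OF normal_fun_oadd normal_fun_oadd] oadd_osuc)

lemma zero_oadd [simp]: "ozero \<oplus> b = (b::'a)"
proof -
  \<comment> \<open>A bound \<open>d < b\<close> would force \<open>osuc d \<le> d\<close>, since
    \<open>osuc d\<close> is below the limit too; hence the identity is normal.\<close>
  have "b \<le> d" if "is_limit b" "\<forall>c<b. c \<le> d" for b d :: 'a
    using that is_limit_osuc_less[of b d] less_osuc[of d] by (meson leD leI)
  then have id: "normal_fun (\<lambda>b::'a. b)" by (simp add: normal_fun_def strict_mono_def)
  show ?thesis
    by (rule normal_fun_ext[OF normal_fun_oadd id, where s = osuc]) (simp_all add: oadd_osuc)
qed

lemma le_imp_oadd:
  assumes "a \<le> (b::'a)"
  obtains c where "b = a \<oplus> c"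
proof -
  obtain c where "a \<oplus> c \<le> b" "b < a \<oplus> osuc c"
    using normal_fun_bracket[OF normal_fun_oadd, of a b] assms by auto
  then have "b = a \<oplus> c" by (simp add: oadd_osuc less_osuc_iff)
  then show thesis by (rule that)
qed

section \<open>Ordinal multiplication\<close>

lemma omult_zero [simp]: "a \<odot> ozero = (ozero::'a)"
  by (simp add: omult_def ord_rec_zero)

lemma omult_osuc: "a \<odot> osuc b = a \<odot> b \<oplus> (a::'a)"
  by (simp add: omult_def ord_rec_osuc)

lemma normal_fun_omult: "ozero < a \<Longrightarrow> normal_fun (\<lambda>b. a \<odot> (b::'a))"
  unfolding omult_def by (rule normal_fun_ord_rec) (rule less_oadd)

lemma omult_one [simp]: "a \<odot> osuc ozero = (a::'a)"
  by (simp add: omult_osuc)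

lemma omult_two: "a \<odot> osuc (osuc ozero) = a \<oplus> (a::'a)"
  by (simp add: omult_osuc[of a "osuc ozero"])

lemma omult_distrib:
  assumes a: "ozero < (a::'a)"
  shows "a \<odot> (b \<oplus> c) = a \<odot> b \<oplus> a \<odot> c"
  by (rule normal_fun_ext[where f = "\<lambda>c. a \<odot> (b \<oplus> c)" and g = "\<lambda>c. a \<odot> b \<oplus> a \<odot> c"
        and s = "\<lambda>c. c \<oplus> a"])
    (simp_all add: normal_fun_comp[OF normal_fun_omult[OF a] normal_fun_oadd] oadd_osuc omult_osuc
      normal_fun_comp[OF normal_fun_oadd normal_fun_omult[OF a]] oadd_assoc)

text \<open>Uniqueness of division: \<open>a \<odot> h\<close> lies between
  \<open>a \<odot> q\<close> and \<open>a \<odot> osuc q\<close>, so \<open>h = q\<close> and the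
  remainder cancels.\<close>

lemma omult_oadd_eq_omult:
  assumes r: "r < (a::'a)" and eq: "a \<odot> h = a \<odot> q \<oplus> r"
  shows "r = ozero"
proof -
  have a: "ozero < a" using r ozero_le[of r] by simp
  have "a \<odot> q \<le> a \<odot> h" "a \<odot> h < a \<odot> osuc q"
    using r by (simp_all add: eq le_oadd omult_osuc)
  then have "h = q"
    using a by (simp add: normal_fun_le_iff[OF normal_fun_omult]
        normal_fun_less_iff[OF normal_fun_omult] less_osuc_iff)
  then show ?thesis using eq oadd_eq_iff[of "a \<odot> q" ozero r] by simp
qed

section \<open>Powers of two\<close>

lemma opow2_zero: "opow2 ozero = (osuc ozero :: 'a)"
  by (simp add: opow2_def ord_rec_zero)

lemma opow2_osuc: "opow2 (osuc a) = opow2 a \<oplus> opow2 (a::'a)"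
  by (simp add: opow2_def ord_rec_osuc omult_two)

lemma normal_fun_opow2: "normal_fun (opow2 :: 'a \<Rightarrow> 'a)"
proof -
  have "c < c \<odot> osuc (osuc ozero)" if "osuc ozero \<le> c" for c :: 'a
    using that by (simp add: omult_two osuc_le_iff less_oadd)
  then have "normal_fun (ord_rec (osuc ozero) (\<lambda>c::'a. c \<odot> osuc (osuc ozero)))"
    by (rule normal_fun_ord_rec)
  then show ?thesis by (simp add: opow2_def[abs_def])
qed

lemmas opow2_less_iff = normal_fun_less_iff[OF normal_fun_opow2]
lemmas opow2_le_iff = normal_fun_le_iff[OF normal_fun_opow2]

lemma opow2_pos: "ozero < opow2 (a::'a)"
  using opow2_le_iff[of ozero a] ozero_le[of a] by (simp add: opow2_zero osuc_le_iff)

text \<open>Both sides are normal in \<open>b\<close>, start at \<open>opow2 a\<close> and double at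
  successors, the right one by distributivity.\<close>

lemma opow2_oadd: "opow2 (a \<oplus> b) = opow2 a \<odot> opow2 (b::'a)"
  by (rule normal_fun_ext[where f = "\<lambda>b. opow2 (a \<oplus> b)" and g = "\<lambda>b. opow2 a \<odot> opow2 b"
        and s = "\<lambda>c. c \<oplus> c"])
    (simp_all add: normal_fun_comp[OF normal_fun_opow2 normal_fun_oadd] oadd_osuc opow2_osuc
      normal_fun_comp[OF normal_fun_omult[OF opow2_pos] normal_fun_opow2] opow2_zero
      omult_distrib[OF opow2_pos])

lemma opow2_multiple:
  assumes "j \<le> (k::'a)"
  obtains h where "opow2 k = opow2 j \<odot> h"
  using le_imp_oadd[OF assms] opow2_oadd by metis

section \<open>Sums of powers of two and normal forms\<close>

abbreviation osum_pow2 :: "'a list \<Rightarrow> 'a" where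
  "osum_pow2 js \<equiv> foldr (\<lambda>j b. opow2 j \<oplus> b) js ozero"

lemma osum_pow2_append: "osum_pow2 (js @ ks) = osum_pow2 js \<oplus> osum_pow2 ks"
  by (induction js) (simp_all add: oadd_assoc)

text \<open>By induction the tail is below \<open>opow2 k\<close> for the leading exponent
  \<open>k\<close>, so the sum is below
  \<open>opow2 k \<oplus> opow2 k = opow2 (osuc k)\<close>.\<close>

lemma osum_pow2_less:
  "\<lbrakk>sorted_wrt (>) js; \<forall>j\<in>set js. j < e\<rbrakk> \<Longrightarrow> osum_pow2 js < opow2 e"
proof (induction js arbitrary: e)
  case Nil
  then show ?case by (simp add: opow2_pos)
next
  case (Cons k ks)
  have "osum_pow2 ks < opow2 k" using Cons by simp
  then have "osum_pow2 (k # ks) < opow2 (osuc k)" by (simp add: opow2_osuc)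
  also have "\<dots> \<le> opow2 e" using Cons.prems by (simp add: opow2_le_iff osuc_le_iff)
  finally show ?case .
qed

lemma opow2_le_osum_pow2: "k \<in> set ks \<Longrightarrow> opow2 k \<le> osum_pow2 ks"
proof (induction ks)
  case (Cons l ks)
  then show ?case
    using le_oadd[of "opow2 l"] le_oadd_right[of "osum_pow2 ks" "opow2 l"] by auto
qed simp

lemma osum_pow2_multiple:
  "\<forall>k\<in>set ks. j \<le> k \<Longrightarrow> \<exists>h. osum_pow2 ks = opow2 j \<odot> h"
proof (induction ks)
  case Nil
  show ?case by (auto intro: exI[of _ ozero])
next
  case (Cons k ks)
  then obtain h where h: "osum_pow2 ks = opow2 j \<odot> h" by auto
  obtain g where g: "opow2 k = opow2 j \<odot> g" using Cons.prems opow2_multiple[of j k] by auto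
  show ?case by (auto simp: h g omult_distrib[OF opow2_pos, symmetric])
qed

text \<open>Greedy expansion: split off the largest power of two below or equal to \<open>a\<close>
  and recurse on the remainder.\<close>

lemma normal_form2_exists: "\<exists>js. normal_form2 (a::'a) js"
proof (induction a rule: less_induct)
  case (less a)
  show ?case
  proof (cases "a = ozero")
    case True
    then show ?thesis by (auto simp: normal_form2_def intro: exI[of _ "[]"])
  next
    case False
    then have "opow2 ozero \<le> a" by (simp add: opow2_zero osuc_le_iff ozero_less_iff)
    then obtain k where k: "opow2 k \<le> a" "a < opow2 (osuc k)"
      using normal_fun_bracket[OF normal_fun_opow2] by blast
    obtain c where c: "a = opow2 k \<oplus> c" using le_imp_oadd[OF k(1)] by blast
    \<comment> \<open>Left cancellation in
      \<open>opow2 k \<oplus> c < opow2 k \<oplus> opow2 k\<close>; this also makes all exponents of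
      \<open>c\<close> smaller than \<open>k\<close>.\<close>
    have "c < opow2 k" using k(2) by (simp add: c opow2_osuc)
    then obtain js where js: "normal_form2 c js"
      using less[of c] k(1) order_less_le_trans by blast
    have "l < k" if "l \<in> set js" for l
    proof -
      have "opow2 l \<le> c" using opow2_le_osum_pow2[OF that] js by (simp add: normal_form2_def)
      then show ?thesis
        using \<open>c < opow2 k\<close> opow2_less_iff[of l k] by (metis order_le_less_trans)
    qed
    then have "normal_form2 a (k # js)" using js c by (simp add: normal_form2_def)
    then show ?thesis ..
  qed
qed

text \<open>If the leading exponents differed, the sum with the smaller one would stay below the
  other leading power. So they agree and can be cancelled.\<close>

lemma osum_pow2_inj:
  "\<lbrakk>sorted_wrt (>) js; sorted_wrt (>) ks; osum_pow2 js = osum_pow2 ks\<rbrakk> \<Longrightarrow> js = ks"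
proof (induction js arbitrary: ks)
  case Nil
  then show ?case
    using opow2_le_osum_pow2[of "hd ks" ks] opow2_pos[of "hd ks"] by (cases ks) auto
next
  case (Cons j js)
  show ?case
  proof (cases ks)
    case Nil
    then show ?thesis
      using Cons.prems opow2_le_osum_pow2[of j "j # js"] opow2_pos[of j] by auto
  next
    case ks: (Cons k ks')
    have "osum_pow2 (j # js) < opow2 k" if "j < k"
      using Cons.prems that by (intro osum_pow2_less) auto
    moreover have "osum_pow2 ks < opow2 j" if "k < j"
      using Cons.prems that ks by (intro osum_pow2_less) auto
    ultimately have "j = k"
      using opow2_le_osum_pow2[of k ks] opow2_le_osum_pow2[of j "j # js"] Cons.prems ks
      by (metis leD linorder_neqE list.set_intros(1))
    then show ?thesis using Cons ks by simp
  qed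
qed

section \<open>Exponent sets\<close>

lemma nf_exps_eq:
  assumes "normal_form2 (a::'a) js"
  shows "nf_exps a = set js"
proof -
  have "(THE js. normal_form2 a js) = js"
    using assms by (intro the_equality) (auto simp: normal_form2_def intro: osum_pow2_inj)
  then show ?thesis by (simp add: nf_exps_def)
qed

lemma nf_exps_zero: "nf_exps (ozero::'a) = {}"
  using nf_exps_eq[of ozero "[]"] by (simp add: normal_form2_def)

lemma nf_exps_opow2: "nf_exps (opow2 (a::'a)) = {a}"
  using nf_exps_eq[of "opow2 a" "[a]"] by (simp add: normal_form2_def)

lemma finite_nf_exps: "finite (nf_exps (a::'a))"
  using normal_form2_exists[of a] nf_exps_eq by auto

lemma nf_exps_less:
  assumes "(a::'a) < opow2 j" and "k \<in> nf_exps a"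
  shows "k < j"
proof -
  obtain js where js: "normal_form2 a js" using normal_form2_exists by blast
  then have "opow2 k \<le> a"
    using assms(2) opow2_le_osum_pow2[of k js] nf_exps_eq[OF js] by (simp add: normal_form2_def)
  then show ?thesis using assms(1) opow2_less_iff[of k j] by (metis order_le_less_trans)
qed

text \<open>The exponents below \<open>j\<close> sum to a remainder of division by
  \<open>opow2 j\<close>. For a multiple this remainder is zero, so there are none.\<close>

lemma nf_exps_omult_ge:
  assumes "k \<in> nf_exps (opow2 j \<odot> (h::'a))"
  shows "j \<le> k"
proof -
  obtain js where js: "normal_form2 (opow2 j \<odot> h) js" using normal_form2_exists by blast
  \<comment> \<open>The list decreases, so its initial run of exponents \<open>\<ge> j\<close>
    contains all of them.\<close>
  define hi lo where "hi = takeWhile (\<lambda>k. j \<le> k) js" and "lo = dropWhile (\<lambda>k. j \<le> k) js"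
  have split: "js = hi @ lo" by (simp add: hi_def lo_def)
  have sorted: "sorted_wrt (>) lo" using js by (auto simp: normal_form2_def split sorted_wrt_append)
  have "\<forall>k\<in>set hi. j \<le> k" by (auto simp: hi_def dest: set_takeWhileD)
  then obtain q where q: "osum_pow2 hi = opow2 j \<odot> q" using osum_pow2_multiple by blast
  have "\<forall>k\<in>set lo. k < j"
  proof (cases lo)
    case (Cons l ls)
    then have "l < j" using hd_dropWhile[of "\<lambda>k. j \<le> k" js] by (auto simp: lo_def)
    then show ?thesis using sorted Cons by auto
  qed simp
  then have "osum_pow2 lo < opow2 j" using sorted by (rule osum_pow2_less[rotated])
  moreover have "opow2 j \<odot> h = opow2 j \<odot> q \<oplus> osum_pow2 lo"
    using js q by (simp add: normal_form2_def split osum_pow2_append del: foldr_append)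
  ultimately have "osum_pow2 lo = ozero" by (rule omult_oadd_eq_omult)
  then have "lo = []" using osum_pow2_inj[OF sorted, of "[]"] by simp
  then show ?thesis
    using assms js \<open>\<forall>k\<in>set hi. j \<le> k\<close> by (simp add: nf_exps_eq split)
qed

text \<open>Exponents of the multiple are \<open>\<ge> j\<close> and those of \<open>a\<close> are
  \<open>< j\<close>, so concatenating the normal forms gives a normal form.\<close>

lemma nf_exps_omult_oadd:
  assumes a: "(a::'a) < opow2 j"
  shows "nf_exps (opow2 j \<odot> h \<oplus> a) = nf_exps (opow2 j \<odot> h) \<union> nf_exps a"
proof -
  obtain js ks where nf: "normal_form2 (opow2 j \<odot> h) js" "normal_form2 a ks"
    using normal_form2_exists by blast
  have "l < k" if "k \<in> set js" "l \<in> set ks" for k l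
    using nf_exps_omult_ge[of k j h] nf_exps_less[OF a, of l] that nf by (simp add: nf_exps_eq)
  then have "normal_form2 (opow2 j \<odot> h \<oplus> a) (js @ ks)"
    using nf by (auto simp: normal_form2_def sorted_wrt_append osum_pow2_append simp del: foldr_append)
  then show ?thesis using nf by (simp add: nf_exps_eq)
qed

section \<open>Counting functions and periodicity\<close>

lemma counting_fun_zero: "counting_fun x (ozero::'a) = 0"
  by (simp add: counting_fun_def nf_exps_zero)

lemma counting_fun_opow2: "counting_fun x (opow2 (a::'a)) = x a"
  by (simp add: counting_fun_def nf_exps_opow2)

lemma counting_fun_omult:
  assumes "\<forall>k\<ge>j. x k = 0"
  shows "counting_fun x (opow2 j \<odot> (h::'a)) = 0"
  unfolding counting_fun_def by (rule sum.neutral) (use assms nf_exps_omult_ge in blast)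

lemma counting_fun_omult_oadd:
  assumes "(a::'a) < opow2 j"
  shows "counting_fun x (opow2 j \<odot> h \<oplus> a) = counting_fun x (opow2 j \<odot> h) + counting_fun x a"
proof -
  have "nf_exps (opow2 j \<odot> h) \<inter> nf_exps a = {}"
    using nf_exps_omult_ge nf_exps_less[OF assms] by (fastforce simp: not_le[symmetric])
  then show ?thesis
    by (simp add: counting_fun_def nf_exps_omult_oadd[OF assms] sum.union_disjoint finite_nf_exps)
qed

lemma periodic_counting_fun: "\<forall>k\<ge>j. x k = 0 \<Longrightarrow> periodic (j::'a) (counting_fun x)"
  by (simp add: periodic_def counting_fun_zero counting_fun_omult_oadd counting_fun_omult)

text \<open>\<open>opow2 k\<close> is a left multiple of \<open>opow2 j\<close>; periodicity with
  remainder zero gives \<open>\<psi> ozero\<close>.\<close>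

lemma periodic_opow2_eq_0:
  assumes "periodic j \<psi>" and "j \<le> (k::'a)"
  shows "\<psi> (opow2 k) = 0"
proof -
  obtain h where "opow2 k = opow2 j \<odot> h \<oplus> ozero"
    using opow2_multiple[OF assms(2)] by (metis oadd_zero)
  then show ?thesis using assms(1) opow2_pos[of j] unfolding periodic_def by metis
qed

lemma periodic_counting_fun_unique:
  assumes "periodic (j::'a) \<psi>"
  shows "\<exists>!x. x \<in> ev_zero \<and> (\<forall>\<alpha>. \<psi> (opow2 \<alpha>) = counting_fun x (opow2 \<alpha>))"
proof (rule ex1I[of _ "\<lambda>k. \<psi> (opow2 k)"])
  show "(\<lambda>k. \<psi> (opow2 k)) \<in> ev_zero \<and>
      (\<forall>\<alpha>. \<psi> (opow2 \<alpha>) = counting_fun (\<lambda>k. \<psi> (opow2 k)) (opow2 \<alpha>))"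
    using periodic_opow2_eq_0[OF assms] by (auto simp: ev_zero_def counting_fun_opow2)
qed (simp add: counting_fun_opow2 fun_eq_iff)

end

section \<open>Regular cardinals and the theorem\<close>

text \<open>An unbounded image of an initial segment would be cofinal, hence of full cardinality by
  regularity, but a proper initial segment of a cardinal is smaller.\<close>

lemma regular_wellorder_if_regularCard:
  assumes card: "Card_order (le_rel :: 'a::wellorder rel)"
    and reg: "regularCard (le_rel :: 'a rel)" and inf: "natLeq <o (le_rel :: 'a rel)"
  shows "regular_wellorder TYPE('a)"
proof
  have field: "Field (le_rel :: 'a rel) = UNIV" by (auto simp: Field_def)
  have "infinite (Field (le_rel :: 'a rel))"
    using inf by
    (meson cinfinite_def cinfinite_mono natLeq_cinfinite ordLess_imp_ordLeq)
  then have limit: "\<exists>b. a < b" for a :: 'a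
    using infinite_Card_order_limit[OF card, of a] by (auto simp: field order_less_le)
  then show "\<exists>b. a < b" for a :: 'a .
  fix b :: 'a and f :: "'a \<Rightarrow> 'a"
  show "\<exists>c. \<forall>a<b. f a \<le> c"
  proof (rule ccontr)
    assume "\<not> ?thesis"
    then have "\<exists>a<b. c < f a" for c by (simp add: not_le)
    then have "cofinal (f ` {..<b}) (le_rel :: 'a rel)"
      unfolding cofinal_def by simp (metis lessThan_iff order_less_le)
    then have "|f ` {..<b}| =o (le_rel :: 'a rel)"
      using reg by (simp add: regularCard_def field)
    moreover have "|f ` {..<b}| \<le>o |{..<b}|" by (rule card_of_image)
    moreover have "|{..<b}| <o (le_rel :: 'a rel)"
    proof -
      have "{..<b} = underS le_rel b" by (auto simp: underS_def)
      then show ?thesis using card_of_underS[OF card, of b] by (simp add: field)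
    qed
    ultimately show False
      using not_ordLess_ordIso ordLeq_ordLess_trans by blast
  qed
qed

theorem theorem2p4:
  assumes "least_strongly_inaccessible (le_rel :: 'a::wellorder rel)"
  shows "(\<forall>(j::'a) (x::'a \<Rightarrow> real). x \<in> ev_zero \<and> (\<forall>k\<ge>j. x k = 0) \<longrightarrow>
            (\<forall>\<alpha> < opow2 j. \<forall>h.
               (\<Sum>k\<in>nf_exps (opow2 j \<odot> h \<oplus> \<alpha>). x k)
                 = (\<Sum>k\<in>nf_exps \<alpha>. x k) + (\<Sum>k\<in>nf_exps (opow2 j \<odot> h). x k) \<and>
               (\<Sum>k\<in>nf_exps \<alpha>. x k) + (\<Sum>k\<in>nf_exps (opow2 j \<odot> h). x k)
                 = (\<Sum>k\<in>nf_exps \<alpha>. x k)) \<and>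
            (\<forall>\<alpha> < opow2 j. \<forall>h.
               counting_fun x (opow2 j \<odot> h \<oplus> \<alpha>)
                 = counting_fun x (opow2 j \<odot> h) + counting_fun x \<alpha> \<and>
               counting_fun x (opow2 j \<odot> h) + counting_fun x \<alpha> = counting_fun x \<alpha>) \<and>
            periodic j (counting_fun x)) \<and>
         (\<forall>(j::'a) (\<psi>::'a \<Rightarrow> real). periodic j \<psi> \<longrightarrow>
            (\<exists>!x. x \<in> ev_zero \<and> (\<forall>\<alpha>. \<psi> (opow2 \<alpha>) = counting_fun x (opow2 \<alpha>))))"
proof -
  interpret regular_wellorder "TYPE('a)"
    using assms by (intro regular_wellorder_if_regularCard)
      (simp_all add: least_strongly_inaccessible_def strongly_inaccessible_def)
  \<comment> \<open>The counting function lemmas, unfolded to the explicit sums of the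
    statement.\<close>
  have part1: "(\<Sum>k\<in>nf_exps (opow2 j \<odot> h \<oplus> \<alpha>). x k)
      = (\<Sum>k\<in>nf_exps \<alpha>. x k) + (\<Sum>k\<in>nf_exps (opow2 j \<odot> h). x k)"
      "(\<Sum>k\<in>nf_exps (opow2 j \<odot> h). x k) = 0"
    if "\<forall>k\<ge>j. x k = 0" and "\<alpha> < opow2 j" for j h \<alpha> :: 'a and x :: "'a \<Rightarrow> real"
    using counting_fun_omult_oadd[OF that(2), of x h] counting_fun_omult[OF that(1), of h]
    by (simp_all add: counting_fun_def)
  show ?thesis
    by (intro conjI allI impI; (elim conjE)?)
      (simp_all only: part1 counting_fun_omult_oadd counting_fun_omult periodic_counting_fun
        periodic_counting_fun_unique add_0_left add_0_right)
qed

end
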